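(* Let $\mathcal{A}\subset\mathbb{R}^d$ be a bounded alphabet with $0\in\mathcal{A}$, let $r,p\ge1$ be integers, let $\mathcal{L}:\mathbb{R}^d\to\mathbb{R}^m$ be a linear operator, let $x^\sharp\in\mathrm{cone}(\mathcal{S}^\sharp)$ for some $\mathcal{S}^\sharp\in\mathrm{slice}_r(\mathcal{A})$, and let $y=\mathcal{L}(x^\sharp)$. Consider the optimization problem $$\inf\Big\{\Big\|\sum_{i=1}^pc_i\mathcal{L}(A_i)-y\Big\|_2^2:\ \sum_{i=1}^pc_i\le\mathcal{G}_{\mathcal{A},p}(x^\sharp),\ c_i\ge0,\ A_i\in\mathcal{A},\ i\in[p]\Big\}\qquad(\star)$$ over $\{c_i\}_{i=1}^p$ and $\{A_i\}_{i=1}^p$. If $x^\sharp=0$, then every solution $\{\widehat c_i,\widehat A_i\}_{i=1}^p$ of $(\star)$ satisfies $\sum_{i=1}^p\widehat c_i\widehat A_i=x^\sharp=0$. Otherwise, suppose that $p\ge r$ and that for every slice $\mathcal{S}\in\mathrm{slice}_p(\mathcal{A})$ the following holds: (i) if $x^\sharp/\mathcal{G}_{\mathcal{A},p}(x^\sharp)\in\mathcal{S}$, then the linear map $\mathcal{L}$ is injective when its domain is restricted to the slice $\mathcal{S}$; (ii) if $x^\sharp/\mathcal{G}_{\mathcal{A},p}(x^\sharp)\notin\mathcal{S}$, then there exists $Q_{\mathcal{S}}\in\mathrm{range}(\mathcal{L}^* )$ such that $$\Big\langle Q_{\mathcal{S}},\,x-\frac{x^\sharp}{\mathcal{G}_{\mathcal{A},p}(x^\sharp)}\Big\rangle<0,\qquad\forall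 x\in\mathcal{S}.$$ Then $(\star)$ recovers $x^\sharp$ and a $p$-sparse decomposition of $x^\sharp$ in $\mathcal{A}$: every solution $\{\widehat c_i,\widehat A_i\}_{i=1}^p$ of $(\star)$ satisfies $x^\sharp=\sum_{i=1}^p\widehat c_i\widehat A_i$.
   Context: An alphabet is a set $\mathcal{A}\subset\mathbb{R}^d$ whose elements are called atoms; it is bounded if $\sup_{A\in\mathcal{A}}\|A\|_2<\infty$. $[p]=\{1,\dots,p\}$; $\mathrm{conv}$ and $\mathrm{cone}$ denote convex and conic hull; $\mathcal{L}^*$ is the adjoint of $\mathcal{L}$. The slice formed by atoms $A_1,\dots,A_l$ is $\mathrm{conv}(\{A_1,\dots,A_l\}\cup\{0\})$; $\mathrm{slice}_p(\mathcal{A})$ is the set of all slices formed by at most $p$ atoms; $\mathrm{conv}_p(\mathcal{A})$ is the union of all slices in $\mathrm{slice}_p(\mathcal{A})$. The gauge$_p$ function is $\mathcal{G}_{\mathcal{A},p}(x)=\inf\{t:x/t\in\mathrm{conv}_p(\mathcal{A}),\ t\ge0\}$ with the convention $0/0=0$. A $p$-sparse decomposition of $x$ in $\mathcal{A}$ is a representation $x=\sum_{i=1}^pc_iA_i$ with $c_i\ge0$, $A_i\in\mathcal{A}$. *)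

theory Defs
  imports "HOL-Analysis.Analysis"
begin

definition slices :: "nat \<Rightarrow> ('a::real_vector) set \<Rightarrow> 'a set set" where
  "slices p \<A> = {convex hull (B \<union> {0}) | B. B \<subseteq> \<A> \<and> finite B \<and> card B \<le> p}"

definition sparse_conv :: "nat \<Rightarrow> ('a::real_vector) set \<Rightarrow> 'a set" where
  "sparse_conv p \<A> = \<Union> (slices p \<A>)"

(* The quotient x / t with t = 0 is admitted only for x = 0 (convention 0/0 = 0). The extra
   conjunct is needed because division by 0 yields 0 in HOL, which would make t = 0 admissible
   for every x. The infimum of the empty set is \<infinity>. *)
definition sparse_gauge :: "('a::real_vector) set \<Rightarrow> nat \<Rightarrow> 'a \<Rightarrow> ereal" where
  "sparse_gauge \<A> p x =
     Inf (ereal ` {t. 0 \<le> t \<and> (t = 0 \<longrightarrow> x = 0) \<and> x /\<^sub>R t \<in> sparse_conv p \<A>})"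

(* In the following, only the values of c and a on {1..p} are relevant. *)
definition sparse_decomposition ::
  "('a::real_vector) set \<Rightarrow> nat \<Rightarrow> 'a \<Rightarrow> (nat \<Rightarrow> real) \<Rightarrow> (nat \<Rightarrow> 'a) \<Rightarrow> bool" where
  "sparse_decomposition \<A> p x c a \<longleftrightarrow>
     (\<forall>i\<in>{1..p}. 0 \<le> c i \<and> a i \<in> \<A>) \<and> x = (\<Sum>i=1..p. c i *\<^sub>R a i)"

definition feasible ::
  "('a::real_vector) set \<Rightarrow> nat \<Rightarrow> 'a \<Rightarrow> (nat \<Rightarrow> real) \<times> (nat \<Rightarrow> 'a) \<Rightarrow> bool" where
  "feasible \<A> p x = (\<lambda>(c, a). ereal (\<Sum>i=1..p. c i) \<le> sparse_gauge \<A> p x \<and>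
     (\<forall>i\<in>{1..p}. 0 \<le> c i \<and> a i \<in> \<A>))"

definition objective ::
  "nat \<Rightarrow> ('a::real_vector \<Rightarrow> 'b::real_normed_vector) \<Rightarrow> 'b \<Rightarrow>
     (nat \<Rightarrow> real) \<times> (nat \<Rightarrow> 'a) \<Rightarrow> real" where
  "objective p \<L> y = (\<lambda>(c, a). (norm ((\<Sum>i=1..p. c i *\<^sub>R \<L> (a i)) - y))\<^sup>2)"

definition is_solution ::
  "('a::real_vector) set \<Rightarrow> nat \<Rightarrow> ('a \<Rightarrow> 'b::real_normed_vector) \<Rightarrow> 'a \<Rightarrow> 'b \<Rightarrow>
     (nat \<Rightarrow> real) \<Rightarrow> (nat \<Rightarrow> 'a) \<Rightarrow> bool" where
  "is_solution \<A> p \<L> x y c a \<longleftrightarrow> is_arg_min (objective p \<L> y) (feasible \<A> p x) (c, a)"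

(* x / gauge(x); meaningful where the gauge is positive and finite. *)
definition gauge_normalize :: "('a::real_vector) set \<Rightarrow> nat \<Rightarrow> 'a \<Rightarrow> 'a" where
  "gauge_normalize \<A> p x = x /\<^sub>R real_of_ereal (sparse_gauge \<A> p x)"

end

theory Submission
  imports Defs
begin

text \<open>
  The infimum of the problem is \<open>0\<close>, although \<open>x / g\<close> (with \<open>g\<close> the gauge of \<open>x\<close>) need not lie in
  \<open>sparse_conv p \<A>\<close> as \<open>\<A>\<close> need not be closed: if \<open>x / t\<close> is in a slice for some \<open>t\<close> slightly above
  \<open>g\<close>, then rescaling by \<open>g\<close> gives a feasible point with value \<open>(1 - g / t)\<^sup>2 \<parallel>y\<parallel>\<^sup>2\<close>. So a solution,
  which attains the infimum, yields \<open>x'\<close> with \<open>\<L> x' = \<L> x\<close> and \<open>x' / g\<close> in the slice \<open>S\<close> of its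
  atoms. As \<open>Q\<close> in the range of the adjoint cannot separate \<open>x' / g\<close> from \<open>x / g\<close>, the latter is in
  \<open>S\<close> as well, and injectivity of \<open>\<L>\<close> on \<open>S\<close> gives \<open>x' = x\<close>.
\<close>

lemma slices_mono: "r \<le> p \<Longrightarrow> slices r \<A> \<subseteq> slices p \<A>"
  by (force simp: slices_def)

lemma zero_in_slice: "S \<in> slices p \<A> \<Longrightarrow> 0 \<in> S"
  by (auto simp: slices_def intro: hull_inc)

lemma zero_in_sparse_conv: "0 \<in> sparse_conv p \<A>"
proof -
  \<comment> \<open>The empty set of atoms spans the slice {0}, whatever \<open>p\<close>
    is.\<close>
  have "convex hull ({} \<union> {0}) \<in> slices p \<A>"
    unfolding slices_def by (intro CollectI exI[of _ "{}"]) auto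
  then show ?thesis
    unfolding sparse_conv_def using zero_in_slice by blast
qed

text \<open>Dropping the term of the vertex 0 keeps the point but may lower the total weight, hence
  a sum of at most 1. A slice may have fewer than \<open>p\<close> atoms; the remaining indices get
  coefficient 0 and the atom 0, which is in the alphabet by assumption.\<close>

lemma sparse_conv_coefficients:
  assumes "0 \<in> \<A>" and "z \<in> sparse_conv p \<A>"
  obtains c a where "\<forall>i\<in>{1..p}. 0 \<le> c i \<and> a i \<in> \<A>" "(\<Sum>i=1..p. c i) \<le> 1"
    "z = (\<Sum>i=1..p. c i *\<^sub>R a i)"
proof -
  obtain B where B: "B \<subseteq> \<A>" "finite B" "card B \<le> p" "z \<in> convex hull (B \<union> {0})"
    using assms(2) by (auto simp: sparse_conv_def slices_def)
  then obtain u where u: "\<forall>v\<in>B \<union> {0}. 0 \<le> u v" "sum u (B \<union> {0}) = 1"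
      "(\<Sum>v\<in>B \<union> {0}. u v *\<^sub>R v) = z"
    using convex_hull_finite[of "B \<union> {0}"] by auto
  have uB: "sum u B \<le> 1"
    using sum_mono2[of "B \<union> {0}" B u] B u by auto
  have zB: "z = (\<Sum>v\<in>B. u v *\<^sub>R v)"
    unfolding u(3)[symmetric] by (rule sum.mono_neutral_right) (use B in auto)
  obtain h where h: "bij_betw h {1..card B} B"
    using ex_bij_betw_nat_finite_1[OF B(2)] by blast
  define c where "c i = (if i \<le> card B then u (h i) else 0)" for i
  define a where "a i = (if i \<le> card B then h i else 0)" for i
  have hB: "h i \<in> B" if "1 \<le> i" "i \<le> card B" for i
    using h that by (auto simp: bij_betw_def)
  show thesis
  proof (rule that)
    show "\<forall>i\<in>{1..p}. 0 \<le> c i \<and> a i \<in> \<A>"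
      using hB u(1) B(1) assms(1) by (auto simp: c_def a_def)
    have "(\<Sum>i=1..p. c i) = (\<Sum>i=1..card B. u (h i))"
      by (rule sum.mono_neutral_cong_right) (use B in \<open>auto simp: c_def\<close>)
    also have "\<dots> = sum u B"
      by (rule sum.reindex_bij_betw[OF h])
    finally show "(\<Sum>i=1..p. c i) \<le> 1" using uB by simp
    have "(\<Sum>i=1..p. c i *\<^sub>R a i) = (\<Sum>i=1..card B. u (h i) *\<^sub>R h i)"
      by (rule sum.mono_neutral_cong_right) (use B in \<open>auto simp: c_def a_def\<close>)
    also have "\<dots> = (\<Sum>v\<in>B. u v *\<^sub>R v)"
      by (rule sum.reindex_bij_betw[OF h])
    finally show "z = (\<Sum>i=1..p. c i *\<^sub>R a i)" using zB by simp
  qed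
qed

text \<open>The missing weight \<open>1 - sum c I\<close> goes to the vertex 0. Indexing by an
  option type, with \<open>None\<close> for that vertex, leaves the old indices untouched, so
  \<open>a\<close> may repeat points or take the value 0.\<close>

lemma subconvex_sum_in_hull:
  assumes "finite I" "\<And>i. i \<in> I \<Longrightarrow> 0 \<le> c i" "sum c I \<le> 1"
  shows "(\<Sum>i\<in>I. c i *\<^sub>R a i) \<in> convex hull (a ` I \<union> {0})"
proof -
  let ?H = "convex hull (a ` I \<union> {0})"
  define c' where "c' j = (case j of None \<Rightarrow> 1 - sum c I | Some i \<Rightarrow> c i)" for j
  define a' where "a' j = (case j of None \<Rightarrow> 0 | Some i \<Rightarrow> a i)" for j
  have "(\<Sum>j\<in>insert None (Some ` I). c' j *\<^sub>R a' j) \<in> ?H"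
  proof (rule convex_sum)
    show "(\<Sum>j\<in>insert None (Some ` I). c' j) = 1"
      using assms(1) by (simp add: c'_def sum.reindex)
  qed (use assms in \<open>auto simp: c'_def a'_def intro!: hull_inc\<close>)
  then show ?thesis
    using assms(1) by (simp add: c'_def a'_def sum.reindex)
qed

lemma slice_of_atoms:
  assumes "\<forall>i\<in>{1..p}. a i \<in> \<A>"
  shows "convex hull (a ` {1..p} \<union> {0}) \<in> slices p \<A>"
  unfolding slices_def using assms card_image_le[of "{1..p}" a] by auto

lemma bounded_sparse_conv:
  fixes \<A> :: "'a::real_normed_vector set"
  assumes "bounded \<A>"
  obtains M where "0 < M" "\<And>z. z \<in> sparse_conv p \<A> \<Longrightarrow> norm z \<le> M"
proof -
  obtain M where M: "0 < M" "\<And>a. a \<in> \<A> \<Longrightarrow> norm a \<le> M"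
    using assms by (auto simp: bounded_pos)
  have "convex hull (B \<union> {0}) \<subseteq> cball 0 M" if "B \<subseteq> \<A>" for B
    by (rule hull_minimal) (use that M in auto)
  then have "sparse_conv p \<A> \<subseteq> cball 0 M"
    unfolding sparse_conv_def slices_def by blast
  then show thesis
    by (intro that[of M] M(1)) auto
qed

lemma sparse_gauge_zero: "sparse_gauge \<A> p 0 \<le> 0"
  unfolding sparse_gauge_def
  by (rule Inf_lower) (auto simp: zero_in_sparse_conv zero_ereal_def intro!: image_eqI[of _ _ 0])

text \<open>An infimum of positive numbers could still be 0, so a uniform lower bound is required:
  slices lie in a ball of radius \<open>M\<close>, which forces \<open>norm x / M\<close> \<le>
  \<open>t\<close> for every admissible \<open>t\<close>.\<close>

lemma sparse_gauge_pos:
  fixes \<A> :: "'a::real_normed_vector set"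
  assumes "bounded \<A>" "x \<noteq> 0"
  shows "0 < sparse_gauge \<A> p x"
proof -
  obtain M where M: "0 < M" "\<And>z. z \<in> sparse_conv p \<A> \<Longrightarrow> norm z \<le> M"
    using bounded_sparse_conv[OF assms(1)] by blast
  have "ereal (norm x / M) \<le> sparse_gauge \<A> p x"
    unfolding sparse_gauge_def
  proof (intro Inf_greatest, clarify)
    fix t :: real assume t: "0 \<le> t" "t = 0 \<longrightarrow> x = 0" "x /\<^sub>R t \<in> sparse_conv p \<A>"
    \<comment> \<open>The convention 0/0 = 0 admits \<open>t = 0\<close> only for
      \<open>x = 0\<close>.\<close>
    then have "0 < t" using assms(2) by force
    then show "ereal (norm x / M) \<le> ereal t"
      using M(2)[OF t(3)] M(1) by (simp add: field_simps)
  qed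
  moreover have "0 < norm x / M" using assms(2) M(1) by simp
  ultimately show ?thesis
    by (metis ereal_less(2) order_less_le_trans)
qed

lemma sparse_gauge_finite:
  assumes "S \<in> slices p \<A>" "x \<in> convex_cone hull S"
  shows "sparse_gauge \<A> p x < \<infinity>"
proof (cases "x = 0")
  case True
  then show ?thesis using sparse_gauge_zero[of \<A> p] by auto
next
  case False
  \<comment> \<open>As \<open>S\<close> is convex, nonzero points of its conic hull are nonnegative
    multiples of points of \<open>S\<close>; the multiplier is an admissible
    \<open>t\<close>.\<close>
  have "convex hull S = S"
    using assms(1) by (auto simp: slices_def)
  then obtain z s where z: "z \<in> S" "0 \<le> s" "x = s *\<^sub>R z"
    using assms(2) False by (auto simp: convex_cone_hull_convex_hull)
  have "s \<noteq> 0" using z False by auto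
  then have "x /\<^sub>R s \<in> sparse_conv p \<A>"
    using z assms(1) by (auto simp: sparse_conv_def)
  then have "sparse_gauge \<A> p x \<le> ereal s"
    unfolding sparse_gauge_def by (intro Inf_lower) (use z \<open>s \<noteq> 0\<close> in auto)
  then show ?thesis by auto
qed

text \<open>Feasibility alone forces this: the budget is at most 0, so all the nonnegative
  coefficients vanish.\<close>

lemma solution_zero:
  assumes "is_solution \<A> p \<L> 0 y c a"
  shows "(\<Sum>i=1..p. c i *\<^sub>R a i) = 0"
proof -
  have "feasible \<A> p 0 (c, a)"
    using assms by (simp add: is_solution_def is_arg_min_def)
  then have c: "ereal (\<Sum>i=1..p. c i) \<le> sparse_gauge \<A> p 0" "\<forall>i\<in>{1..p}. 0 \<le> c i"
    by (auto simp: feasible_def)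
  have "ereal (\<Sum>i=1..p. c i) \<le> 0"
    using c(1) sparse_gauge_zero order_trans by blast
  then have "(\<Sum>i=1..p. c i) = 0"
    using c(2) sum_nonneg[of "{1..p}" c] by simp
  then have "\<forall>i\<in>{1..p}. c i = 0"
    using c(2) by (subst (asm) sum_nonneg_eq_0_iff) auto
  then show ?thesis by simp
qed

lemma solution_attains_zero:
  assumes lin: "linear \<L>" and "0 \<in> \<A>"
    and g: "sparse_gauge \<A> p x = ereal g" "0 < g"
    and sol: "is_solution \<A> p \<L> x (\<L> x) c a"
  shows "\<L> (\<Sum>i=1..p. c i *\<^sub>R a i) = \<L> x"
proof -
  interpret linear \<L> by (fact lin)
  have obj: "objective p \<L> (\<L> x) (c, a) = (norm (\<L> (\<Sum>i=1..p. c i *\<^sub>R a i) - \<L> x))\<^sup>2" for c a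
    by (simp add: objective_def sum scale)
  define v where "v = norm (\<L> (\<Sum>i=1..p. c i *\<^sub>R a i) - \<L> x)"
  \<comment> \<open>Here \<open>d\<close> is the relative slack allowed above the gauge: a
    \<open>t\<close> below \<open>g * (1 + d)\<close> costs at most \<open>d * norm (\<L> x)\<close>
    in the residual.\<close>
  have v_le: "v \<le> d * norm (\<L> x)" if "0 < d" for d
  proof -
    have "sparse_gauge \<A> p x < ereal (g * (1 + d))"
      using g that by simp
    then obtain t where t: "0 \<le> t" "x /\<^sub>R t \<in> sparse_conv p \<A>" "t < g * (1 + d)"
        and tset: "t \<in> {t. 0 \<le> t \<and> (t = 0 \<longrightarrow> x = 0) \<and> x /\<^sub>R t \<in> sparse_conv p \<A>}"
      unfolding sparse_gauge_def Inf_less_iff by auto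
    have "sparse_gauge \<A> p x \<le> ereal t"
      unfolding sparse_gauge_def using tset by (intro Inf_lower imageI)
    then have gt: "g \<le> t" using g by simp
    obtain c' a' where ca: "\<forall>i\<in>{1..p}. 0 \<le> c' i \<and> a' i \<in> \<A>" "(\<Sum>i=1..p. c' i) \<le> 1"
        "x /\<^sub>R t = (\<Sum>i=1..p. c' i *\<^sub>R a' i)"
      using sparse_conv_coefficients[OF \<open>0 \<in> \<A>\<close> t(2)] by metis
    \<comment> \<open>Scaling by \<open>t\<close> would reproduce \<open>x\<close> exactly but could
      exceed the budget; scaling by \<open>g\<close> respects it and yields \<open>(g / t)\<close>
      times \<open>x\<close>.\<close>
    have "feasible \<A> p x (\<lambda>i. g * c' i, a')"
      using ca g by (simp add: feasible_def flip: sum_distrib_left)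
    then have "\<not> objective p \<L> (\<L> x) (\<lambda>i. g * c' i, a') < objective p \<L> (\<L> x) (c, a)"
      using sol by (simp add: is_solution_def is_arg_min_def)
    moreover have "(\<Sum>i=1..p. (g * c' i) *\<^sub>R a' i) = g *\<^sub>R (x /\<^sub>R t)"
      unfolding ca(3) by (simp add: scaleR_sum_right)
    ultimately have "v\<^sup>2 \<le> (norm ((g / t) *\<^sub>R \<L> x - \<L> x))\<^sup>2"
      unfolding obj v_def by (simp add: scale divide_inverse not_less)
    then have "v \<le> norm ((g / t) *\<^sub>R \<L> x - \<L> x)"
      using norm_ge_zero power2_le_imp_le by blast
    also have "(g / t) *\<^sub>R \<L> x - \<L> x = (g / t - 1) *\<^sub>R \<L> x"
      by (simp add: scaleR_diff_left)
    also have "norm \<dots> = (1 - g / t) * norm (\<L> x)"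
      using gt g by (simp add: field_simps)
    also have "1 - g / t \<le> d"
    proof -
      have "t - g \<le> g * d" using t(3) by (simp add: algebra_simps)
      also have "\<dots> \<le> t * d" using gt that by simp
      finally show ?thesis using gt g by (simp add: field_simps)
    qed
    finally show ?thesis by (simp add: mult_right_mono)
  qed
  have "v \<le> 0"
  proof (rule field_le_epsilon)
    fix e :: real assume "0 < e"
    \<comment> \<open>The added 1 keeps the denominator positive when \<open>\<L> x\<close> is
      0.\<close>
    have "v \<le> e / (norm (\<L> x) + 1) * norm (\<L> x)"
      by (rule v_le) (use \<open>0 < e\<close> in \<open>simp add: add_nonneg_pos\<close>)
    also have "\<dots> \<le> e"
      using \<open>0 < e\<close> by (simp add: pos_divide_le_eq add_nonneg_pos)
    finally show "v \<le> 0 + e" by simp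
  qed
  then show ?thesis by (simp add: v_def)
qed

theorem lemma3p11:
  fixes \<A> :: "(real ^ 'd) set"
    and \<L> :: "real ^ 'd \<Rightarrow> real ^ 'm"
    and r p :: nat
    and x :: "real ^ 'd" and y :: "real ^ 'm" and S0 :: "(real ^ 'd) set"
  assumes "bounded \<A>" and "0 \<in> \<A>"
    and "1 \<le> r" and "1 \<le> p"
    and "linear \<L>"
    and "S0 \<in> slices r \<A>" and "x \<in> convex_cone hull S0"
    and "y = \<L> x"
  shows "(x = 0 \<longrightarrow>
           (\<forall>c a. is_solution \<A> p \<L> x y c a \<longrightarrow> (\<Sum>i=1..p. c i *\<^sub>R a i) = 0)) \<and>
         (x \<noteq> 0 \<longrightarrow> r \<le> p \<longrightarrow>
           (\<forall>S \<in> slices p \<A>.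
              (gauge_normalize \<A> p x \<in> S \<longrightarrow> inj_on \<L> S) \<and>
              (gauge_normalize \<A> p x \<notin> S \<longrightarrow>
                 (\<exists>Q \<in> range (adjoint \<L>). \<forall>z \<in> S. Q \<bullet> (z - gauge_normalize \<A> p x) < 0))) \<longrightarrow>
           (\<forall>c a. is_solution \<A> p \<L> x y c a \<longrightarrow> sparse_decomposition \<A> p x c a))"
proof (intro conjI impI allI)
  fix c a assume "x = 0" "is_solution \<A> p \<L> x y c a"
  then show "(\<Sum>i=1..p. c i *\<^sub>R a i) = 0"
    using solution_zero by blast
next
  fix c a
  assume "x \<noteq> 0" "r \<le> p"
    and slice: "\<forall>S \<in> slices p \<A>.
      (gauge_normalize \<A> p x \<in> S \<longrightarrow> inj_on \<L> S) \<and>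
      (gauge_normalize \<A> p x \<notin> S \<longrightarrow>
         (\<exists>Q \<in> range (adjoint \<L>). \<forall>z \<in> S. Q \<bullet> (z - gauge_normalize \<A> p x) < 0))"
    and sol: "is_solution \<A> p \<L> x y c a"
  \<comment> \<open>This is where \<open>r \<le> p\<close> enters: it makes the gauge for
    \<open>p\<close> atoms finite at \<open>x\<close>.\<close>
  have "S0 \<in> slices p \<A>"
    using slices_mono[OF \<open>r \<le> p\<close>] assms(6) by blast
  then obtain g where g: "sparse_gauge \<A> p x = ereal g" "0 < g"
    using sparse_gauge_pos[OF assms(1) \<open>x \<noteq> 0\<close>, of p] sparse_gauge_finite[of S0 p \<A> x] assms(7)
    by (cases "sparse_gauge \<A> p x") auto
  have ca: "(\<Sum>i=1..p. c i) \<le> g" "\<forall>i\<in>{1..p}. 0 \<le> c i \<and> a i \<in> \<A>"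
    using sol g by (auto simp: is_solution_def is_arg_min_def feasible_def)
  define x' where "x' = (\<Sum>i=1..p. c i *\<^sub>R a i)"
  have Lx': "\<L> x' = \<L> x"
    unfolding x'_def
    by (rule solution_attains_zero) (use assms g sol in auto)
  define S where "S = convex hull (a ` {1..p} \<union> {0})"
  have S: "S \<in> slices p \<A>"
    unfolding S_def using ca(2) by (intro slice_of_atoms) auto
  \<comment> \<open>Division by \<open>g\<close> turns the budget into total weight at most
    1.\<close>
  have "(\<Sum>i=1..p. (c i / g) *\<^sub>R a i) \<in> S"
    unfolding S_def using ca g
    by (intro subconvex_sum_in_hull) (auto simp flip: sum_divide_distrib)
  then have x'S: "x' /\<^sub>R g \<in> S"
    by (simp add: x'_def scaleR_sum_right divide_inverse mult.commute)
  have norm_x: "gauge_normalize \<A> p x = x /\<^sub>R g"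
    by (simp add: gauge_normalize_def g)
  have Leq: "\<L> (x' /\<^sub>R g) = \<L> (x /\<^sub>R g)"
    using Lx' by (simp add: linear_scale[OF assms(5)])
  have "x /\<^sub>R g \<in> S"
  proof (rule ccontr)
    assume "x /\<^sub>R g \<notin> S"
    then obtain q where "adjoint \<L> q \<bullet> (x' /\<^sub>R g - x /\<^sub>R g) < 0"
      using slice S x'S unfolding norm_x by blast
    \<comment> \<open>Moving the adjoint to the other side leaves the inner product of
      \<open>q\<close> with a difference of equal images under \<open>\<L>\<close>.\<close>
    moreover have "adjoint \<L> q \<bullet> (x' /\<^sub>R g - x /\<^sub>R g) = 0"
      unfolding adjoint_clauses(2)[OF assms(5)] linear_diff[OF assms(5)] Leq by simp
    ultimately show False by simp
  qed
  then have "x' /\<^sub>R g = x /\<^sub>R g"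
    using slice S x'S Leq unfolding norm_x by (blast dest: inj_onD)
  then have "x' = x" using g by simp
  then show "sparse_decomposition \<A> p x c a"
    using ca by (simp add: sparse_decomposition_def x'_def)
qed

end
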